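(* Let $n$ be a positive integer and let $G=(U,V,E)$ be a bipartite graph with $U=\{u_1,\dots,u_n\}$, $V=\{v_1,\dots,v_n\}$ and $E\subseteq U\times V$. For every integer $k$ with $n\ge k>\frac{n}{2}$, $$\sum_{1\le i,j\le n}\mathbf{1}\Big\{|\deg(u_i)-\deg(v_j)|\ge k\Big\}\le 2k(n-k).$$
   Context: $\deg(w)$ denotes the degree of vertex $w$ in $G$, and $\mathbf{1}\{\cdot\}$ is the indicator of the event in braces. *)

theory Defs
  imports Complex_Main
begin

text \<open>An edge between \<open>x \<in> U\<close> and \<open>y \<in> V\<close> is encoded as the pair \<open>(x, y)\<close>. Both parts live in one
  vertex type, so their disjointness is required explicitly.\<close>

definition bipartite_graph :: "'a set \<Rightarrow> 'a set \<Rightarrow> ('a \<times> 'a) set \<Rightarrow> bool" where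
  "bipartite_graph U V E \<longleftrightarrow> finite U \<and> finite V \<and> U \<inter> V = {} \<and> E \<subseteq> U \<times> V"

definition deg :: "('a \<times> 'a) set \<Rightarrow> 'a \<Rightarrow> nat" where
  "deg E w = card {e \<in> E. w = fst e \<or> w = snd e}"

end

theory Submission
  imports Defs
begin

text \<open>Put \<open>m = n - k\<close>. For a threshold \<open>a\<close>, the pairs with \<open>deg v - deg u \<ge> k\<close> are covered by the
  rows \<open>deg u < a\<close> together with the columns \<open>deg v \<ge> a + k\<close>. Some threshold uses at most \<open>m\<close> lines:
  otherwise, matching the \<open>m + 1\<close> vertices \<open>u\<close> of smallest degree with the \<open>m + 1\<close> vertices \<open>v\<close> of
  largest degree in opposite orders gives \<open>m + 1\<close> disjoint such pairs, whose degree sums differ by at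
  least \<open>(m + 1)k\<close>; but each such \<open>v\<close> has at most \<open>n - m - 1 = k - 1\<close> neighbours outside the matching,
  so they differ by at most \<open>(m + 1)(k - 1)\<close>. The pairs with \<open>deg u - deg v \<ge> k\<close> are covered likewise.
  Since \<open>2k > n\<close>, the two kinds of pairs occupy disjoint sets of rows and disjoint sets of columns, and
  optimising the sizes of the two covers yields \<open>2m(n - m)\<close>.\<close>

lemma ex_rank_enumeration:
  fixes f :: "'a \<Rightarrow> 'b::linorder"
  assumes "finite X"
  obtains e where "bij_betw e {..<card X} X"
    and "\<And>i. i < card X \<Longrightarrow> card {x \<in> X. f x < f (e i)} \<le> i"
proof -
  obtain ys where "set ys = X" "distinct ys"
    using finite_distinct_list[OF assms] by blast
  define xs where "xs = sort_key f ys"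
  have xs: "set xs = X" "distinct xs" "sorted (map f xs)" "length xs = card X"
    using \<open>set ys = X\<close> \<open>distinct ys\<close> by (auto simp: xs_def distinct_card)
  show thesis
  proof
    show "bij_betw ((!) xs) {..<card X} X"
      using xs by (intro bij_betw_nth) auto
    fix i assume "i < card X"
    have "{x \<in> X. f x < f (xs ! i)} \<subseteq> (!) xs ` {..<i}"
    proof
      fix x assume "x \<in> {x \<in> X. f x < f (xs ! i)}"
      then obtain j where j: "x = xs ! j" "j < length xs" "f (xs ! j) < f (xs ! i)"
        using xs by (auto simp: in_set_conv_nth)
      then have "\<not> i \<le> j"
        using sorted_nth_mono[OF xs(3), of i j] by auto
      with j show "x \<in> (!) xs ` {..<i}" by auto
    qed
    then show "card {x \<in> X. f x < f (xs ! i)} \<le> i"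
      using surj_card_le[of "{..<i}"] by simp
  qed
qed

lemma thresholds_large_imp_le_card:
  fixes f :: "'a \<Rightarrow> nat" and g :: "'b \<Rightarrow> nat"
  assumes fin: "finite X" "finite Y"
    and large: "\<And>a. m \<le> card {x \<in> X. f x < a} + card {y \<in> Y. a + k \<le> g y}"
  shows "m \<le> card X" "m \<le> card Y"
proof -
  have "{y \<in> Y. Suc (sum g Y) + k \<le> g y} = {}"
    using member_le_sum[of _ Y g] fin(2) by fastforce
  then have "m \<le> card {x \<in> X. f x < Suc (sum g Y)}"
    using large[of "Suc (sum g Y)"] by (metis add_0_right card.empty)
  also have "\<dots> \<le> card X"
    using fin(1) by (intro card_mono) auto
  finally show "m \<le> card X" .
  have "m \<le> card {y \<in> Y. k \<le> g y}"
    using large[of 0] by simp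
  also have "\<dots> \<le> card Y"
    using fin(2) by (intro card_mono) auto
  finally show "m \<le> card Y" .
qed

lemma thresholds_large_imp_ex_gap_matching:
  fixes f :: "'a \<Rightarrow> nat" and g :: "'b \<Rightarrow> nat"
  assumes fin: "finite X" "finite Y"
    and large: "\<And>a. m \<le> card {x \<in> X. f x < a} + card {y \<in> Y. a + k \<le> g y}"
  obtains d e where "inj_on d {..<m}" "inj_on e {..<m}" "d ` {..<m} \<subseteq> X" "e ` {..<m} \<subseteq> Y"
    and "\<And>i. i < m \<Longrightarrow> f (d i) + k \<le> g (e i)"
proof -
  have le_card: "m \<le> card X" "m \<le> card Y"
    using thresholds_large_imp_le_card[OF fin large] by auto
  obtain d where d: "bij_betw d {..<card X} X"
    and rank_d: "\<And>i. i < card X \<Longrightarrow> card {x \<in> X. f x < f (d i)} \<le> i"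
    using ex_rank_enumeration[OF fin(1), of f] by blast
  obtain e where e: "bij_betw e {..<card Y} Y"
    and rank_e: "\<And>i. i < card Y \<Longrightarrow> card {y \<in> Y. - int (g y) < - int (g (e i))} \<le> i"
    using ex_rank_enumeration[OF fin(2), of "\<lambda>y. - int (g y)"] by blast
  show thesis
  proof
    show "inj_on d {..<m}" "d ` {..<m} \<subseteq> X"
      using d le_card by (auto simp: bij_betw_def intro: inj_on_subset)
    have "inj_on (\<lambda>i. m - Suc i) {..<m}"
      by (auto simp: inj_on_def)
    moreover have "inj_on e ((\<lambda>i. m - Suc i) ` {..<m})"
      using e le_card by (auto simp: bij_betw_def intro: inj_on_subset)
    ultimately show "inj_on (\<lambda>i. e (m - Suc i)) {..<m}"
      using comp_inj_on by (fastforce simp: comp_def)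
    show "(\<lambda>i. e (m - Suc i)) ` {..<m} \<subseteq> Y"
      using e le_card by (auto simp: bij_betw_def)
    fix i assume "i < m"
    show "f (d i) + k \<le> g (e (m - Suc i))"
    proof (rule ccontr)
      assume "\<not> f (d i) + k \<le> g (e (m - Suc i))"
      then have "card {y \<in> Y. f (d i) + k \<le> g y}
          \<le> card {y \<in> Y. - int (g y) < - int (g (e (m - Suc i)))}"
        using fin(2) by (intro card_mono) auto
      also have "\<dots> \<le> m - Suc i"
        using rank_e le_card \<open>i < m\<close> by simp
      finally show False
        using large[of "f (d i)"] rank_d[of i] le_card \<open>i < m\<close> by linarith
    qed
  qed
qed

lemma sum_card_converse_Image_le:
  assumes "finite X" "finite Y" "R \<subseteq> X \<times> Y" "P \<subseteq> X" "Q \<subseteq> Y"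
  shows "(\<Sum>y\<in>Q. card (R\<inverse> `` {y})) \<le> (\<Sum>x\<in>P. card (R `` {x})) + card Q * (card X - card P)"
proof -
  have fin: "finite P" "finite Q"
    using assms finite_subset by blast+
  have "card (R\<inverse> `` {y}) \<le> card {x \<in> P. (x, y) \<in> R} + (card X - card P)" for y
  proof -
    have "card (R\<inverse> `` {y}) \<le> card ({x \<in> P. (x, y) \<in> R} \<union> (X - P))"
      using assms fin by (intro card_mono) auto
    also have "\<dots> \<le> card {x \<in> P. (x, y) \<in> R} + card (X - P)"
      by (rule card_Un_le)
    finally show ?thesis
      using assms fin by (simp add: card_Diff_subset)
  qed
  then have "(\<Sum>y\<in>Q. card (R\<inverse> `` {y})) \<le> (\<Sum>y\<in>Q. card {x \<in> P. (x, y) \<in> R} + (card X - card P))"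
    by (intro sum_mono)
  also have "\<dots> = (\<Sum>y\<in>Q. card {x \<in> P. (x, y) \<in> R}) + card Q * (card X - card P)"
    by (simp add: sum.distrib)
  also have "(\<Sum>y\<in>Q. card {x \<in> P. (x, y) \<in> R}) = (\<Sum>x\<in>P. card {y \<in> Q. (x, y) \<in> R})"
    using fin by (intro sum_multicount_gen) auto
  also have "\<dots> \<le> (\<Sum>x\<in>P. card (R `` {x}))"
    using assms by (intro sum_mono card_mono finite_subset[of "R `` _" Y]) auto
  finally show ?thesis by simp
qed

definition degree_gap :: "'a set \<Rightarrow> 'b set \<Rightarrow> ('a \<times> 'b) set \<Rightarrow> nat \<Rightarrow> ('a \<times> 'b) set" where
  "degree_gap X Y R k = {(x, y) \<in> X \<times> Y. card (R `` {x}) + k \<le> card (R\<inverse> `` {y})}"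

lemma degree_gap_subset: "degree_gap X Y R k \<subseteq> X \<times> Y"
  by (auto simp: degree_gap_def)

lemma finite_degree_gap: "finite X \<Longrightarrow> finite Y \<Longrightarrow> finite (degree_gap X Y R k)"
  by (rule finite_subset[OF degree_gap_subset]) simp

lemma degree_gap_matching_card_le:
  assumes fin: "finite X" "finite Y" and R: "R \<subseteq> X \<times> Y"
    and inj: "inj_on d I" "inj_on e I"
    and gap: "\<And>i. i \<in> I \<Longrightarrow> (d i, e i) \<in> degree_gap X Y R k"
  shows "card I \<le> card X - k"
proof (cases "card I = 0")
  case False
  have sub: "d ` I \<subseteq> X" "e ` I \<subseteq> Y"
    using gap by (auto simp: degree_gap_def)
  have card: "card (d ` I) = card I" "card (e ` I) = card I"
    using inj by (simp_all add: card_image)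
  have "(\<Sum>x\<in>d ` I. card (R `` {x})) + card I * k = (\<Sum>i\<in>I. card (R `` {d i}) + k)"
    using inj by (simp add: sum.reindex sum.distrib)
  also have "\<dots> \<le> (\<Sum>i\<in>I. card (R\<inverse> `` {e i}))"
    using gap by (intro sum_mono) (auto simp: degree_gap_def)
  also have "\<dots> = (\<Sum>y\<in>e ` I. card (R\<inverse> `` {y}))"
    using inj by (simp add: sum.reindex)
  also have "\<dots> \<le> (\<Sum>x\<in>d ` I. card (R `` {x})) + card I * (card X - card I)"
    using sum_card_converse_Image_le[OF fin R sub] card by simp
  finally have "k \<le> card X - card I"
    using False by simp
  moreover have "card I \<le> card X"
    using card_mono[OF fin(1) sub(1)] card by simp
  ultimately show ?thesis by simp
qed simp

lemma ex_small_threshold: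
  assumes fin: "finite X" "finite Y" and R: "R \<subseteq> X \<times> Y"
  shows "\<exists>a. card {x \<in> X. card (R `` {x}) < a} + card {y \<in> Y. a + k \<le> card (R\<inverse> `` {y})} \<le> card X - k"
proof (rule ccontr)
  let ?m = "Suc (card X - k)"
  assume "\<not> ?thesis"
  then have large: "?m \<le> card {x \<in> X. card (R `` {x}) < a} + card {y \<in> Y. a + k \<le> card (R\<inverse> `` {y})}" for a
    by (simp add: Suc_le_eq not_le)
  obtain d e where inj: "inj_on d {..<?m}" "inj_on e {..<?m}"
    and sub: "d ` {..<?m} \<subseteq> X" "e ` {..<?m} \<subseteq> Y"
    and gap: "\<And>i. i < ?m \<Longrightarrow> card (R `` {d i}) + k \<le> card (R\<inverse> `` {e i})"
    using thresholds_large_imp_ex_gap_matching[OF fin large] by blast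
  have "(d i, e i) \<in> degree_gap X Y R k" if "i \<in> {..<?m}" for i
    using that sub gap by (auto simp: degree_gap_def)
  then have "card {..<?m} \<le> card X - k"
    using degree_gap_matching_card_le[OF fin R inj] by blast
  then show False by simp
qed

lemma card_le_of_line_cover:
  assumes "finite B" "H \<subseteq> Domain B" "C \<subseteq> Range B" "B \<subseteq> H \<times> UNIV \<union> UNIV \<times> C"
  shows "card B \<le> card H * card (Range B) + (card (Domain B) - card H) * card C"
proof -
  have fin: "finite (Domain B)" "finite (Range B)" "finite H" "finite C"
    using assms finite_Domain finite_Range finite_subset by metis+
  have "card B \<le> card (H \<times> Range B \<union> (Domain B - H) \<times> C)"
    using assms fin by (intro card_mono) auto
  also have "\<dots> \<le> card (H \<times> Range B) + card ((Domain B - H) \<times> C)"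
    by (rule card_Un_le)
  finally show ?thesis
    using assms fin by (simp add: card_cartesian_product card_Diff_subset)
qed

lemma degree_gap_line_cover:
  fixes k :: nat
  assumes fin: "finite X" "finite Y" and R: "R \<subseteq> X \<times> Y"
  defines "B \<equiv> degree_gap X Y R k"
  obtains h c where "h \<le> card (Domain B)" "c \<le> card (Range B)" "h + c \<le> card X - k"
    and "card B \<le> h * card (Range B) + (card (Domain B) - h) * c"
proof -
  have finB: "finite B"
    using finite_degree_gap[OF fin] by (simp add: B_def)
  obtain a where a: "card {x \<in> X. card (R `` {x}) < a} + card {y \<in> Y. a + k \<le> card (R\<inverse> `` {y})}
      \<le> card X - k"
    using ex_small_threshold[OF fin R] by blast
  define H where "H = {x \<in> Domain B. card (R `` {x}) < a}"
  define C where "C = {y \<in> Range B. a + k \<le> card (R\<inverse> `` {y})}"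
  have sub: "H \<subseteq> Domain B" "C \<subseteq> Range B"
    by (auto simp: H_def C_def)
  have "card H \<le> card {x \<in> X. card (R `` {x}) < a}" "card C \<le> card {y \<in> Y. a + k \<le> card (R\<inverse> `` {y})}"
    using fin degree_gap_subset by (fastforce simp: H_def C_def B_def intro!: card_mono)+
  with a have "card H + card C \<le> card X - k" by linarith
  moreover have "B \<subseteq> H \<times> UNIV \<union> UNIV \<times> C"
    by (force simp: B_def H_def C_def degree_gap_def)
  then have "card B \<le> card H * card (Range B) + (card (Domain B) - card H) * card C"
    using finB sub by (intro card_le_of_line_cover)
  moreover have "card H \<le> card (Domain B)" "card C \<le> card (Range B)"
    using finB sub by (simp_all add: card_mono finite_Domain finite_Range)
  ultimately show thesis
    using that by blast
qed

lemma card_Domain_degree_gap_add_card_Range_le: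
  assumes fin: "finite X" and R: "R \<subseteq> X \<times> Y" and k: "card X < 2 * k"
  shows "card (Domain (degree_gap X Y R k)) + card (Range (degree_gap Y X (R\<inverse>) k)) \<le> card X"
proof -
  have "card (R\<inverse> `` {y}) \<le> card X" for y
    using fin R by (intro card_mono) auto
  then have "card (R `` {x}) < k" if "x \<in> Domain (degree_gap X Y R k)" for x
    using that k by (force simp: degree_gap_def dest: le_trans)
  moreover have "k \<le> card (R `` {x})" if "x \<in> Range (degree_gap Y X (R\<inverse>) k)" for x
    using that by (auto simp: degree_gap_def)
  ultimately have disj: "Domain (degree_gap X Y R k) \<inter> Range (degree_gap Y X (R\<inverse>) k) = {}"
    by (meson disjoint_iff not_le)
  have sub: "Domain (degree_gap X Y R k) \<subseteq> X" "Range (degree_gap Y X (R\<inverse>) k) \<subseteq> X"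
    by (auto simp: degree_gap_def)
  then show ?thesis
    using fin disj card_mono[OF fin, of "Domain (degree_gap X Y R k) \<union> Range (degree_gap Y X (R\<inverse>) k)"]
    by (simp add: card_Un_disjoint finite_subset)
qed

lemma weighted_sum_le_of_le:
  fixes a b c n q t :: "'a::linordered_idom"
  assumes "0 \<le> a" "b \<le> a" "c \<le> t" "q + t \<le> n"
  shows "a * q + b * t \<le> a * (n - c) + b * c"
proof -
  have "a * q \<le> a * (n - t)"
    using assms by (intro mult_left_mono) (auto simp: le_diff_eq)
  moreover have "(a - b) * c \<le> (a - b) * t"
    using assms by (intro mult_left_mono) auto
  ultimately show ?thesis by (simp add: algebra_simps)
qed

lemma weighted_sum_le_max:
  fixes a b c d :: "'a::linordered_idom"
  assumes "0 \<le> a" "0 \<le> b"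
  shows "a * c + b * d \<le> (a + b) * max c d"
  using assms by (simp add: distrib_right add_mono mult_left_mono)

text \<open>The first cover uses \<open>h\<close> full rows, each meeting \<open>q\<close> columns, and \<open>c\<close> columns in the remaining
  \<open>p\<close> rows; the second uses \<open>h'\<close> rows over \<open>t\<close> columns, and \<open>c'\<close> columns in the remaining \<open>s\<close> rows.\<close>

lemma two_line_covers_le_of_le:
  fixes n m :: "'a::linordered_idom"
  assumes nonneg: "0 \<le> h'" "0 \<le> c" "0 \<le> c'" "0 \<le> p" "0 \<le> s"
    and lines: "h + c \<le> m" "h' + c' \<le> m" "2 * m \<le> n"
    and rows: "(h + p) + (h' + s) \<le> n"
    and cols: "q + t \<le> n" "c' \<le> t"
    and "h' \<le> h"
  shows "(h * q + p * c) + (h' * t + s * c') \<le> 2 * m * (n - m)"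
proof -
  define d where "d = max c c'"
  have "h * q + h' * t \<le> h * (n - c') + h' * c'"
    using assms by (intro weighted_sum_le_of_le) auto
  moreover have "p * c + s * c' \<le> (p + s) * d"
    using nonneg weighted_sum_le_max by (simp add: d_def)
  moreover have "(p + s) * d \<le> (n - h - h') * d"
    using rows nonneg by (intro mult_right_mono) (auto simp: d_def algebra_simps)
  ultimately have "(h * q + p * c) + (h' * t + s * c')
      \<le> n * (h + d) - (h - h') * c' - (h + h') * d"
    by (simp add: algebra_simps)
  also have "\<dots> \<le> 2 * m * (n - m)"
  proof (cases "c \<le> c'")
    case True
    have "0 \<le> (m - h) * (n - 2 * c')" "0 \<le> (m - c') * (n - 2 * m)"
      using assms by (auto intro!: mult_nonneg_nonneg)
    with True show ?thesis by (simp add: d_def algebra_simps)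
  next
    case False
    have "0 \<le> (h - h') * c'" "0 \<le> (h + h') * d" "0 \<le> (m - (h + c)) * n" "0 \<le> m * (n - 2 * m)"
      using assms by (auto intro!: mult_nonneg_nonneg simp: d_def)
    with False show ?thesis by (simp add: d_def algebra_simps)
  qed
  finally show ?thesis .
qed

lemma two_line_covers_le:
  fixes n m :: "'a::linordered_idom"
  assumes "0 \<le> h" "0 \<le> h'" "0 \<le> c" "0 \<le> c'" "0 \<le> p" "0 \<le> s"
    and "h + c \<le> m" "h' + c' \<le> m" "2 * m \<le> n"
    and "(h + p) + (h' + s) \<le> n"
    and "q + t \<le> n" "c \<le> q" "c' \<le> t"
  shows "(h * q + p * c) + (h' * t + s * c') \<le> 2 * m * (n - m)"
proof (cases "h' \<le> h")
  case True
  then show ?thesis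
    using assms by (intro two_line_covers_le_of_le)
next
  case False
  then have "(h' * t + s * c') + (h * q + p * c) \<le> 2 * m * (n - m)"
    using assms by (intro two_line_covers_le_of_le) (auto simp: add.commute)
  then show ?thesis by (simp add: add.commute)
qed

lemma card_degree_gap_add_converse_le:
  assumes fin: "finite X" "finite Y" and card: "card X = n" "card Y = n"
    and R: "R \<subseteq> X \<times> Y" and k: "k \<le> n" "n < 2 * k"
  shows "int (card (degree_gap X Y R k) + card (degree_gap Y X (R\<inverse>) k))
    \<le> 2 * int k * (int n - int k)"
proof -
  let ?B = "degree_gap X Y R k" and ?A = "degree_gap Y X (R\<inverse>) k"
  have R_conv: "R\<inverse> \<subseteq> Y \<times> X"
    using R by auto
  obtain h c where cover_B: "h \<le> card (Domain ?B)" "c \<le> card (Range ?B)" "h + c \<le> n - k"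
    "card ?B \<le> h * card (Range ?B) + (card (Domain ?B) - h) * c"
    using degree_gap_line_cover[OF fin R] card by metis
  obtain c' h' where cover_A: "c' \<le> card (Domain ?A)" "h' \<le> card (Range ?A)" "c' + h' \<le> n - k"
    "card ?A \<le> c' * card (Range ?A) + (card (Domain ?A) - c') * h'"
    using degree_gap_line_cover[OF fin(2,1) R_conv] card by metis
  have card_A: "card ?A \<le> h' * card (Domain ?A) + (card (Range ?A) - h') * c'"
    using cover_A by (simp add: algebra_simps diff_mult_distrib)
  have rows: "card (Domain ?B) + card (Range ?A) \<le> n"
    using card_Domain_degree_gap_add_card_Range_le[OF fin(1) R] card k by simp
  have cols: "card (Range ?B) + card (Domain ?A) \<le> n"
    using card_Domain_degree_gap_add_card_Range_le[OF fin(2) R_conv] card k by (simp add: add.commute)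
  have "int (card ?B + card ?A) \<le> int ((h * card (Range ?B) + (card (Domain ?B) - h) * c)
      + (h' * card (Domain ?A) + (card (Range ?A) - h') * c'))"
    using cover_B card_A by (simp only: of_nat_le_iff add_mono)
  also have "\<dots> = (int h * card (Range ?B) + int (card (Domain ?B) - h) * c)
      + (int h' * card (Domain ?A) + int (card (Range ?A) - h') * c')"
    by simp
  also have "\<dots> \<le> 2 * int (n - k) * (int n - int (n - k))"
    using cover_B cover_A rows cols k by (intro two_line_covers_le) linarith+
  finally show ?thesis
    using k by (simp add: of_nat_diff mult_ac)
qed

lemma card_large_degree_difference_le:
  assumes fin: "finite X" "finite Y" and card: "card X = n" "card Y = n"
    and R: "R \<subseteq> X \<times> Y" and k: "k \<le> n" "n < 2 * k"
  shows "int (card {(x, y) \<in> X \<times> Y. int k \<le> \<bar>int (card (R `` {x})) - int (card (R\<inverse> `` {y}))\<bar>})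
    \<le> 2 * int k * (int n - int k)"
proof -
  have "{(x, y) \<in> X \<times> Y. int k \<le> \<bar>int (card (R `` {x})) - int (card (R\<inverse> `` {y}))\<bar>}
      = degree_gap X Y R k \<union> (degree_gap Y X (R\<inverse>) k)\<inverse>"
    by (auto simp: degree_gap_def)
  then have "card {(x, y) \<in> X \<times> Y. int k \<le> \<bar>int (card (R `` {x})) - int (card (R\<inverse> `` {y}))\<bar>}
      \<le> card (degree_gap X Y R k) + card (degree_gap Y X (R\<inverse>) k)"
    using card_Un_le by (metis card_inverse)
  then show ?thesis
    using card_degree_gap_add_converse_le[OF assms] by linarith
qed

lemma deg_eq_card_Image:
  assumes "bipartite_graph U V E" "x \<in> U"
  shows "deg E x = card (E `` {x})"
proof -
  have "{e \<in> E. x = fst e \<or> x = snd e} = Pair x ` (E `` {x})"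
    using assms by (force simp: bipartite_graph_def)
  then show ?thesis
    by (simp add: deg_def card_image inj_on_def)
qed

lemma bipartite_graph_converse: "bipartite_graph U V E \<Longrightarrow> bipartite_graph V U (E\<inverse>)"
  by (auto simp: bipartite_graph_def)

lemma deg_converse: "deg (E\<inverse>) w = deg E w"
proof -
  have "{e \<in> E\<inverse>. w = fst e \<or> w = snd e} = {e \<in> E. w = fst e \<or> w = snd e}\<inverse>"
    by auto
  then show ?thesis
    by (simp add: deg_def)
qed

theorem theorem1:
  fixes n :: nat
    and u v :: "nat \<Rightarrow> 'a"
    and U V :: "'a set"
    and E :: "('a \<times> 'a) set"
    and k :: int
  assumes "n \<ge> 1"
    and "bipartite_graph U V E"
    and "U = u ` {1..n}" and "inj_on u {1..n}"
    and "V = v ` {1..n}" and "inj_on v {1..n}"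
    and "k \<le> int n" and "real_of_int k > real n / 2"
  shows "(\<Sum>(i, j) \<in> {1..n} \<times> {1..n}.
            of_bool (\<bar>int (deg E (u i)) - int (deg E (v j))\<bar> \<ge> k) :: int)
         \<le> 2 * k * (int n - k)"
proof -
  have UV: "finite U" "finite V" "card U = n" "card V = n" "E \<subseteq> U \<times> V"
    using assms(2-6) by (auto simp: card_image bipartite_graph_def)
  obtain l where l: "k = int l" "l \<le> n" "n < 2 * l"
    using assms(7,8) by (cases k) auto
  have bij: "bij_betw (map_prod u v) ({1..n} \<times> {1..n}) (U \<times> V)"
    using assms(3-6) by (intro bij_betw_map_prod) (auto simp: bij_betw_def)
  have degs: "deg E x = card (E `` {x})" "deg E y = card (E\<inverse> `` {y})" if "x \<in> U" "y \<in> V" for x y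
    using that deg_eq_card_Image[OF assms(2)] deg_eq_card_Image[OF bipartite_graph_converse[OF assms(2)]]
    by (auto simp: deg_converse)
  have "(\<Sum>(i, j) \<in> {1..n} \<times> {1..n}. of_bool (\<bar>int (deg E (u i)) - int (deg E (v j))\<bar> \<ge> k) :: int)
      = (\<Sum>(x, y) \<in> U \<times> V. of_bool (\<bar>int (deg E x) - int (deg E y)\<bar> \<ge> k))"
    by (subst sum.reindex_bij_betw[OF bij, symmetric]) (simp add: case_prod_beta)
  also have "\<dots> = int (card {(x, y) \<in> U \<times> V. k \<le> \<bar>int (deg E x) - int (deg E y)\<bar>})"
    using UV by (auto simp: case_prod_beta intro!: arg_cong[where f = card])
  also have "{(x, y) \<in> U \<times> V. k \<le> \<bar>int (deg E x) - int (deg E y)\<bar>}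
      = {(x, y) \<in> U \<times> V. int l \<le> \<bar>int (card (E `` {x})) - int (card (E\<inverse> `` {y}))\<bar>}"
    using degs l by auto
  also have "int (card \<dots>) \<le> 2 * int l * (int n - int l)"
    using UV l by (intro card_large_degree_difference_le)
  finally show ?thesis
    by (simp add: l)
qed

end
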